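(* Let $t$ be an exponential formal variable marking $x$, and let $z,w$ be formal variables. The following identities of formal power series hold (in (i)–(iii), for every fixed integer $n\ge0$). (i) $\displaystyle\sum_{x\ge0}n^x\frac{t^x}{x!}=e^{nt}$ and $\displaystyle\sum_{x\ge0}(1+n)^x\frac{t^x}{x!}=e^{(1+n)t}$. (ii) $\displaystyle\sum_{x\ge0}\Bigl(\sum_{k=0}^{n}S(x,k)\Bigr)\frac{t^x}{x!}=\sum_{k=0}^{n}\frac{(e^t-1)^k}{k!}$, and $\displaystyle\sum_{x\ge0}\Bigl(\sum_{k=0}^{x}\sum_{l=0}^{n}\binom xk S(k,l)\Bigr)\frac{t^x}{x!}=e^t\sum_{l=0}^{n}\frac{(e^t-1)^l}{l!}$. (iii) $\displaystyle\sum_{x\ge0}\binom{n+x-1}{x}w^x=(1-w)^{-n}$ and $\displaystyle\sum_{x\ge0}\binom{n+x}{x}w^x=(1-w)^{-(n+1)}$. (iv) Writing $p_{\le n}(x)$ for the number of partitions of the integer $x$ into at most $n$ parts, $$\sum_{n,x\ge0}p_{\le n}(x)z^nw^x=\prod_{i\ge0}\frac1{1-zw^i}.$$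
   Context: $S(x,k)$ is the Stirling number of the second kind (number of partitions of an $x$-element set into exactly $k$ nonempty blocks, with $S(0,0)=1$). Conventions: $0^0=1$ and $\binom{-1}{0}=1$. (For orientation: with $|N|=n$, $|X|=x$, the pairs of sequences in (i), (ii), (iii) are respectively the numbers of all, of $S_N$-orbits, and of $S_X$-orbits of functions $X\to N$ and of functions $X\to N\cup\{\ast\}$, where $\ast\notin N$ is fixed by the group; $p_{\le n}(x)$ in (iv) is the number of $S_N\times S_X$-orbits of functions $X\to N$.) *)

theory Defs
  imports
    "HOL-Computational_Algebra.Formal_Power_Series"
    "HOL-Combinatorics.Stirling"
    "HOL-Library.Disjoint_Sets"
    "HOL-Library.Multiset"
    "HOL-Analysis.Infinite_Products"
begin

text \<open>
  The library defines \<^const>\<open>Stirling\<close> by its recurrence. The following lemmas connect it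
  with the count of set partitions into a given number of (nonempty) blocks.
\<close>

lemma set_partitions_insert:
  assumes "finite A" "a \<notin> A"
  shows "{P. partition_on (insert a A) P \<and> card P = Suc k} =
    insert {a} ` {P. partition_on A P \<and> card P = k} \<union>
    (\<lambda>(P, B). insert (insert a B) (P - {B})) ` (SIGMA P:{P. partition_on A P \<and> card P = Suc k}. P)"
    (is "?L = ?R1 \<union> ?R2")
proof (intro equalityI subsetI)
  fix Q assume "Q \<in> ?L"
  then have Q: "partition_on (insert a A) Q" "card Q = Suc k" by auto
  have finQ: "finite Q" using Q(2) card_ge_0_finite by force
  obtain C where C: "C \<in> Q" "a \<in> C" using partition_onD1[OF Q(1)] by auto
  have Q': "partition_on (insert a A - C) (Q - {C})" "C \<subseteq> insert a A"
    using partition_on_insert[of C "Q - {C}" "insert a A"] partition_onD2[OF Q(1)] Q(1) C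
    by (auto simp: insert_absorb disjnt_def pairwise_def partition_on_def)
  have card: "card (Q - {C}) = k" using Q(2) C finQ by simp
  show "Q \<in> ?R1 \<union> ?R2"
  proof (cases "C = {a}")
    case True
    then have "partition_on A (Q - {C})" using Q'(1) assms(2) by simp
    moreover have "Q = insert {a} (Q - {C})" using True C by auto
    ultimately show ?thesis using card by blast
  next
    case False
    define B where "B = C - {a}"
    have BA: "B \<subseteq> A" "B \<noteq> {}" "C = insert a B" "a \<notin> B"
      using False C Q'(2) by (auto simp: B_def)
    have eqA: "insert a A - C = A - B" using BA(3) assms(2) by auto
    have notin: "B \<notin> Q - {C}" using Q'(1) eqA BA unfolding partition_on_def by blast
    have disj: "disjnt B (\<Union>(Q - {C}))"
      using Q'(1) eqA unfolding partition_on_def disjnt_def by blast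
    have "partition_on A (insert B (Q - {C}))"
      using partition_on_insert[OF disj, of A] Q'(1) eqA BA by simp
    moreover have "card (insert B (Q - {C})) = Suc k" using notin card finQ by simp
    moreover have "Q = insert (insert a B) (insert B (Q - {C}) - {B})"
      using notin C BA by auto
    ultimately have "Q \<in> ?R2"
      by (intro image_eqI[of _ _ "(insert B (Q - {C}), B)"]) auto
    then show ?thesis by blast
  qed
next
  fix Q assume "Q \<in> ?R1 \<union> ?R2"
  then show "Q \<in> ?L"
  proof
    assume "Q \<in> ?R1"
    then obtain P where P: "partition_on A P" "card P = k" "Q = insert {a} P" by auto
    have fin: "finite P" using finite_elements assms(1) P(1) by blast
    have "{a} \<notin> P" "disjnt {a} (\<Union>P)" using P(1) assms(2) by (auto simp: partition_on_def)
    moreover have "insert a A - {a} = A" using assms(2) by auto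
    ultimately show ?thesis using P fin partition_on_insert[of "{a}" P "insert a A"] by auto
  next
    assume "Q \<in> ?R2"
    then obtain P B where P: "partition_on A P" "card P = Suc k" "B \<in> P"
      "Q = insert (insert a B) (P - {B})" by auto
    have fin: "finite P" using finite_elements assms(1) P(1) by blast
    have B: "B \<subseteq> A" "a \<notin> B" using P(1,3) assms(2) by (auto simp: partition_on_def)
    have d: "disjnt B (\<Union>(P - {B}))"
      using P(1,3) by (auto simp: partition_on_def disjoint_def disjnt_def)
    have p: "partition_on (A - B) (P - {B})"
      using partition_on_insert[OF d, of A] P(1,3) by (simp add: insert_absorb)
    have e: "insert a A - insert a B = A - B" using assms(2) by auto
    have d': "disjnt (insert a B) (\<Union>(P - {B}))"
      using d P(1) assms(2) by (auto simp: partition_on_def disjnt_def)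
    have "partition_on (insert a A) Q"
      using partition_on_insert[OF d', of "insert a A"] p e B P(4) by auto
    moreover have "insert a B \<notin> P" using P(1) assms(2) by (auto simp: partition_on_def)
    then have "card Q = Suc k" using P fin by simp
    ultimately show ?thesis by simp
  qed
qed

lemma card_set_partitions:
  fixes A :: "'a set"
  assumes "finite A"
  shows "card {P. partition_on A P \<and> card P = k} = Stirling (card A) k"
  using assms
proof (induction A arbitrary: k rule: finite_induct)
  case empty
  have E: "{P. partition_on ({} :: 'a set) P \<and> card P = k} = (if k = 0 then {{}} else {})"
    by (auto simp: partition_on_empty)
  show ?case unfolding E by (cases k) simp_all
next
  case (insert a A)
  show ?case
  proof (cases k)
    case 0
    have "{P. partition_on (insert a A) P \<and> card P = 0} = {}"
    proof -
      have False if P: "partition_on (insert a A) P" "card P = 0" for P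
      proof -
        have "finite P" using finite_elements[OF _ P(1)] insert.hyps(1) by simp
        then show False using P by (auto simp: partition_on_def)
      qed
      then show ?thesis by blast
    qed
    then have "card {P. partition_on (insert a A) P \<and> card P = 0} = 0" by (simp only: card.empty)
    then show ?thesis using insert.hyps 0 by simp
  next
    case (Suc m)
    let ?S = "\<lambda>j. {P. partition_on A P \<and> card P = j}"
    let ?f = "\<lambda>(P, B). insert (insert a B) (P - {B})"
    let ?T = "SIGMA P:?S (Suc m). P"
    have fin: "finite (?S j)" for j
      using finitely_many_partition_on[OF insert.hyps(1)] by (rule rev_finite_subset) auto
    have finP: "finite P" if "P \<in> ?S j" for P j
      using that finite_elements[OF insert.hyps(1)] by simp
    have aP: "a \<notin> B" if "P \<in> ?S j" "B \<in> P" for P B j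
      using that insert.hyps(2) by (auto simp: partition_on_def)
    have finT: "finite ?T" by (rule finite_SigmaI[OF fin finP])
    have inj1: "inj_on (insert {a}) (?S m)"
    proof (rule inj_onI)
      fix P P' assume "P \<in> ?S m" "P' \<in> ?S m" and eq: "insert {a} P = insert {a} P'"
      then have "{a} \<notin> P" "{a} \<notin> P'" using aP by blast+
      then show "P = P'" using eq by (simp add: insert_ident)
    qed
    have inj2: "inj_on ?f ?T"
    proof (rule inj_onI, clarify)
      fix P B P' B'
      assume P: "partition_on A P" "card P = Suc m" "B \<in> P"
        and P': "partition_on A P'" "card P' = Suc m" "B' \<in> P'"
        and eq: "insert (insert a B) (P - {B}) = insert (insert a B') (P' - {B'})"
      have na: "\<And>C. C \<in> P \<Longrightarrow> a \<notin> C" "\<And>C. C \<in> P' \<Longrightarrow> a \<notin> C"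
        using aP[of P "Suc m"] aP[of P' "Suc m"] P(1,2) P'(1,2) by simp_all
      have "insert a B \<in> insert (insert a B') (P' - {B'})" using eq by blast
      then have "insert a B = insert a B'" using na(2)[of "insert a B"] by auto
      then have BB: "B = B'" using na(1)[OF P(3)] na(2)[OF P'(3)] by (simp add: insert_ident)
      moreover have "insert a B \<notin> P - {B}" "insert a B \<notin> P' - {B'}"
        using na(1)[of "insert a B"] na(2)[of "insert a B"] by auto
      then have "P - {B} = P' - {B'}" using eq BB by (simp add: insert_ident)
      ultimately show "P = P' \<and> B = B'" using P(3) P'(3) by blast
    qed
    have disj: "insert {a} ` ?S m \<inter> ?f ` ?T = {}"
    proof -
      have False if H: "partition_on A P" "partition_on A P'" "B \<in> P'"
        "insert {a} P = insert (insert a B) (P' - {B})" for P P' B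
      proof -
        have "{a} \<notin> P'" using H(2) insert.hyps(2) by (auto simp: partition_on_def)
        then have "{a} = insert a B" using H(4) by auto
        then have "B = {}" using H(2,3) insert.hyps(2) by (auto simp: partition_on_def)
        then show False using H(2,3) by (auto simp: partition_on_def)
      qed
      then show ?thesis by fastforce
    qed
    have "card ?T = (\<Sum>P\<in>?S (Suc m). card P)"
      using card_SigmaI[OF fin, of "Suc m" "\<lambda>P. P"] finP by blast
    also have "\<dots> = Suc m * card (?S (Suc m))" by simp
    finally have T: "card ?T = Suc m * Stirling (card A) (Suc m)" using insert.IH by simp
    have "card {P. partition_on (insert a A) P \<and> card P = Suc m} = card (?S m) + card ?T"
      unfolding set_partitions_insert[OF insert.hyps]
      by (simp only: card_Un_disjoint[OF finite_imageI[OF fin] finite_imageI[OF finT] disj]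
        card_image[OF inj1] card_image[OF inj2])
    also have "\<dots> = Stirling (Suc (card A)) (Suc m)" using T insert.IH by simp
    finally show ?thesis using Suc insert.hyps by simp
  qed
qed

text \<open>
  An integer partition is the multiset of its parts, which are positive;
  \<open>p_le n x\<close> counts the partitions of \<open>x\<close> into at most \<open>n\<close> parts. The set
  of these partitions is finite, as the next lemma records, so \<^const>\<open>card\<close> is the honest count.
\<close>

definition p_le :: "nat \<Rightarrow> nat \<Rightarrow> nat" where
  "p_le n x = card {M :: nat multiset. 0 \<notin># M \<and> sum_mset M = x \<and> size M \<le> n}"

lemma finite_p_le: "finite {M :: nat multiset. 0 \<notin># M \<and> sum_mset M = x \<and> size M \<le> n}"
proof (rule finite_subset)
  show "{M :: nat multiset. 0 \<notin># M \<and> sum_mset M = x \<and> size M \<le> n}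
      \<subseteq> mset ` {xs. set xs \<subseteq> {..x} \<and> length xs \<le> n}"
  proof
    fix M :: "nat multiset"
    assume M: "M \<in> {M. 0 \<notin># M \<and> sum_mset M = x \<and> size M \<le> n}"
    obtain xs where xs: "M = mset xs" by (metis ex_mset)
    have "set xs \<subseteq> {..x}" using M xs member_le_sum_list by (auto simp: sum_mset_sum_list)
    then show "M \<in> mset ` {xs. set xs \<subseteq> {..x} \<and> length xs \<le> n}" using M xs by auto
  qed
  show "finite (mset ` {xs. set xs \<subseteq> {..x} \<and> length xs \<le> n})"
    by (intro finite_imageI finite_lists_length_le) simp
qed

text \<open>
  Power series in two variables \<open>z\<close>, \<open>w\<close> are power series in \<open>w\<close> whose coefficients are
  power series in \<open>z\<close>. With \<open>w\<close> as the outer variable, the metric on \<^typ>\<open>'a fps fps\<close> is the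
  \<open>w\<close>-adic one (coefficients being discrete), in which
  a product of the factors \<open>1 / (1 - z w^i)\<close> over all \<open>i\<close> converges; it would not converge
  \<open>z\<close>-adically, since every factor has a nonzero term linear in \<open>z\<close>.
\<close>

definition var_z :: "'a::comm_ring_1 fps fps" where "var_z = fps_const fps_X"

definition var_w :: "'a::comm_ring_1 fps fps" where "var_w = fps_X"

text \<open>The double series with coefficient \<open>a n x\<close> at \<open>z^n w^x\<close>.\<close>

definition fps2 :: "(nat \<Rightarrow> nat \<Rightarrow> 'a) \<Rightarrow> 'a fps fps" where
  "fps2 a = Abs_fps (\<lambda>x. Abs_fps (\<lambda>n. a n x))"

end

theory Submission
  imports Defs
begin

text \<open>
  Only the Stirling numbers and the product formula need an idea. For the former, the series
  \<open>H k = (exp t - 1)^k / k!\<close> satisfies \<open>H (k + 1)' = (k + 1) H (k + 1) + H k\<close> (write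
  \<open>exp t = (exp t - 1) + 1\<close> in the derivative), and this is the recurrence of the Stirling
  numbers, read off at coefficients (\<open>fps_nth_exp_minus_one_power_div_fact\<close>). The factor
  \<open>exp t\<close> in the second Stirling identity amounts to a binomial convolution with the constant
  sequence 1 (\<open>binomial_convolution_egf\<close>). The powers of \<open>1 - w\<close> are instances of the binomial
  series, with the sign of the upper index absorbed by \<open>gbinomial_minus\<close>.

  For the product formula, let \<open>F(z, w)\<close> be the double series of \<open>p_le n x\<close>. Partitions of \<open>x\<close> into exactly
  \<open>n\<close> parts correspond to partitions of \<open>x - n\<close> into at most \<open>n\<close> parts, by lowering each part by
  one (\<open>p_le_Suc\<close>). As a functional equation this says \<open>(1 - z) F(z, w) = F(z w, w)\<close>, and
  substituting \<open>z w^m\<close> for \<open>z\<close> gives \<open>(1 - z w^m) F(z w^m, w) = F(z w^(m+1), w)\<close>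
  (\<open>partition_series_step\<close>). Hence \<open>F(z, w)\<close> times the first \<open>m\<close> factors \<open>1 - z w^i\<close>
  telescopes to \<open>F(z w^m, w)\<close>. This agrees with \<open>F(0, w) = 1\<close> in all coefficients of \<open>w\<close>
  below \<open>m\<close>, so multiplying by the inverse factors shows that the partial products of the
  \<open>1 / (1 - z w^i)\<close> agree with \<open>F\<close> in those coefficients as well.
\<close>

unbundle no vec_syntax
unbundle fps_syntax

section \<open>Exponential generating functions of Stirling numbers\<close>

text \<open>
  The differential equation \<open>H (k + 1)' = (k + 1) H (k + 1) + H k\<close> for
  \<open>H k = (exp t - 1)^k / k!\<close>, together with the constant coefficients, determines the numbers
  \<open>x! [t^x] H k\<close> by induction on \<open>x\<close>, for all \<open>k\<close> at once, and they satisfy the defining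
  recurrence of \<^const>\<open>Stirling\<close>.
\<close>

lemma fps_nth_exp_minus_one_power_div_fact:
  "((fps_exp 1 - 1) ^ k / fact k :: 'a::field_char_0 fps) $ x = of_nat (Stirling x k) / fact x"
proof -
  define H :: "nat \<Rightarrow> 'a fps" where "H k = (fps_exp 1 - 1) ^ k * fps_const (1 / fact k)" for k
  have H_eq: "(fps_exp 1 - 1) ^ k / fact k = H k" for k
  proof -
    have "(fact k :: 'a fps) = fps_const (fact k)"
      by (metis fps_of_nat of_nat_fact)
    then show ?thesis
      by (simp add: H_def fps_divide_unit fps_const_inverse inverse_eq_divide)
  qed
  have H_0: "H 0 = 1"
    by (simp add: H_def)
  have H_nth_0: "H (Suc k) $ 0 = 0" for k
    by (simp add: H_def)
  have H_deriv: "fps_deriv (H (Suc k)) = of_nat (Suc k) * H (Suc k) + H k" for k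
  proof -
    have e: "fps_const (of_nat (Suc k)) * fps_const (1 / fact (Suc k)) = fps_const (1 / fact k :: 'a)"
      by (simp add: fps_const_mult del: of_nat_Suc)
    have "fps_deriv (H (Suc k)) =
        (fps_exp 1 - 1) ^ k * fps_exp 1 * (fps_const (of_nat (Suc k)) * fps_const (1 / fact (Suc k)))"
      by (simp add: H_def fps_deriv_power del: fps_const_mult of_nat_Suc power_Suc fact_Suc)
    also have "\<dots> = (fps_exp 1 - 1) ^ Suc k * (fps_const (of_nat (Suc k)) * fps_const (1 / fact (Suc k)))
        + (fps_exp 1 - 1) ^ k * (fps_const (of_nat (Suc k)) * fps_const (1 / fact (Suc k)))"
      by (simp add: algebra_simps del: fps_const_mult of_nat_Suc fact_Suc)
    also have "\<dots> = of_nat (Suc k) * H (Suc k) + H k"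
      unfolding e H_def fps_of_nat[symmetric] by (simp only: e[symmetric] mult_ac)
    finally show ?thesis .
  qed
  have H_nth_Suc: "of_nat (Suc x) * H (Suc k) $ Suc x = of_nat (Suc k) * H (Suc k) $ x + H k $ x"
    for x k
    using arg_cong[OF H_deriv[of k], of "\<lambda>f. f $ x"]
    by (simp add: fps_of_nat[symmetric] del: of_nat_Suc)
  have "fact x * H k $ x = of_nat (Stirling x k)"
  proof (induction x arbitrary: k)
    case 0
    then show ?case
      by (cases k) (simp_all add: H_0 H_nth_0)
  next
    case (Suc x)
    show ?case
    proof (cases k)
      case 0
      then show ?thesis
        by (simp add: H_0)
    next
      case (Suc j)
      have "fact (Suc x) * H k $ Suc x = fact x * (of_nat (Suc x) * H (Suc j) $ Suc x)"
        by (simp add: Suc)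
      also have "\<dots> = of_nat (Suc j) * (fact x * H (Suc j) $ x) + fact x * H j $ x"
        unfolding H_nth_Suc by (simp add: algebra_simps)
      finally show ?thesis
        unfolding Suc by (simp add: Suc.IH algebra_simps)
    qed
  qed
  then show ?thesis
    by (simp add: H_eq field_simps)
qed

lemma Stirling_sum_egf:
  "Abs_fps (\<lambda>x. of_nat (\<Sum>k=0..n. Stirling x k) / fact x)
    = (\<Sum>k=0..n. (fps_exp 1 - 1) ^ k / fact k :: 'a::field_char_0 fps)"
  by (rule fps_ext)
    (simp add: fps_sum_nth fps_nth_exp_minus_one_power_div_fact sum_divide_distrib)

lemma binomial_convolution_egf:
  fixes a :: "nat \<Rightarrow> nat"
  shows "Abs_fps (\<lambda>x. of_nat (\<Sum>k=0..x. (x choose k) * a k) / fact x)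
    = (fps_exp 1 * Abs_fps (\<lambda>x. of_nat (a x) / fact x) :: 'a::field_char_0 fps)"
proof (rule fps_ext)
  fix x
  have "(fps_exp 1 * Abs_fps (\<lambda>x. of_nat (a x) / fact x) :: 'a fps) $ x
      = (\<Sum>k=0..x. of_nat (a k) / fact k * (1 / fact (x - k)))"
    by (subst mult.commute) (simp add: fps_mult_nth)
  also have "\<dots> = (\<Sum>k=0..x. of_nat (x choose k) * of_nat (a k) / fact x)"
    by (intro sum.cong refl) (simp add: binomial_fact field_simps)
  finally show "Abs_fps (\<lambda>x. of_nat (\<Sum>k=0..x. (x choose k) * a k) / fact x) $ x
      = (fps_exp 1 * Abs_fps (\<lambda>x. of_nat (a x) / fact x) :: 'a fps) $ x"
    by (simp add: sum_divide_distrib)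
qed

section \<open>Negative binomial series\<close>

lemma one_minus_fps_X_powi_minus_nth:
  "((1 - fps_X) powi (- int n) :: 'a::field_char_0 fps) $ x = (of_nat n + of_nat x - 1) gchoose x"
proof -
  have "(1 - fps_X) powi (- int n) = (inverse ((1 - fps_X) ^ n) :: 'a fps)"
    by (cases "n = 0") (simp_all add: power_int_def fps_inverse_power)
  also have "\<dots> = fps_compose (fps_binomial (- of_nat n)) (fps_const (- 1) * fps_X)"
    using one_minus_fps_X_const_neg_power[of "1 :: 'a" n] by (simp del: fps_const_neg add: fps_const_neg[symmetric])
  also have "\<dots> $ x = (-1) ^ x * ((- of_nat n) gchoose x)"
    by (simp only: fps_compose_linear fps_nth_Abs_fps fps_binomial_nth)
  also have "\<dots> = (of_nat n + of_nat x - 1) gchoose x"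
    by (simp add: gbinomial_minus flip: mult.assoc power_mult_distrib)
  finally show ?thesis .
qed

section \<open>Partitions into at most \<open>n\<close> parts\<close>

lemma p_le_0: "p_le 0 x = (if x = 0 then 1 else 0)"
proof -
  have "{M :: nat multiset. 0 \<notin># M \<and> sum_mset M = x \<and> size M \<le> 0} = (if x = 0 then {{#}} else {})"
    by auto
  then show ?thesis
    by (simp add: p_le_def)
qed

lemma filter_positive_add_zeros:
  fixes L :: "nat multiset"
  assumes "size L = n"
  shows "filter_mset (\<lambda>x. x \<noteq> 0) L + replicate_mset (n - size (filter_mset (\<lambda>x. x \<noteq> 0) L)) 0 = L"
proof -
  have "filter_mset (\<lambda>x. \<not> x \<noteq> 0) L = replicate_mset (count L 0) 0"
    by (metis (mono_tags, lifting) filter_eq_replicate_mset filter_mset_cong)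
  then have L: "L = filter_mset (\<lambda>x. x \<noteq> 0) L + replicate_mset (count L 0) 0"
    using multiset_partition[of L "\<lambda>x. x \<noteq> 0"] by metis
  then have "size L = size (filter_mset (\<lambda>x. x \<noteq> 0) L) + count L 0"
    by (metis size_union size_replicate_mset)
  then have "n - size (filter_mset (\<lambda>x. x \<noteq> 0) L) = count L 0"
    using assms by linarith
  then show ?thesis
    by (simp only: L[symmetric])
qed

lemma sum_mset_image_Suc: "sum_mset (image_mset Suc L) = sum_mset L + size L"
  by (induction L) auto

lemma sum_mset_filter_nonzero: "sum_mset (filter_mset (\<lambda>x. x \<noteq> 0) L) = sum_mset (L :: nat multiset)"
  by (induction L) auto

text \<open>
  Lower every part by one and drop the parts that become 0. The inverse map pads with
  zeros to exactly \<open>n\<close> parts before raising every part by one; the number of dropped zeros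
  can be recovered because \<open>n\<close> is fixed.
\<close>

lemma card_partitions_exact:
  "card {M :: nat multiset. 0 \<notin># M \<and> sum_mset M = x + n \<and> size M = n} = p_le n x"
proof -
  let ?E = "{M :: nat multiset. 0 \<notin># M \<and> sum_mset M = x + n \<and> size M = n}"
  let ?P = "{M :: nat multiset. 0 \<notin># M \<and> sum_mset M = x \<and> size M \<le> n}"
  define f where "f M = filter_mset (\<lambda>x. x \<noteq> 0) (image_mset (\<lambda>x. x - 1) M)" for M :: "nat multiset"
  define g where "g N = image_mset Suc (N + replicate_mset (n - size N) 0)" for N
  have Suc_pred: "image_mset Suc (image_mset (\<lambda>x. x - 1) M) = M" if "0 \<notin># M" for M :: "nat multiset"
  proof -
    have "image_mset (\<lambda>x. Suc (x - 1)) M = image_mset id M"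
      by (rule image_mset_cong) (use that in \<open>metis Suc_diff_1 id_apply not_gr_zero\<close>)
    then show ?thesis
      by (simp add: multiset.map_comp comp_def)
  qed
  have "bij_betw f ?E ?P"
  proof (rule bij_betw_byWitness[where f' = g])
    show "\<forall>M\<in>?E. g (f M) = M"
      using filter_positive_add_zeros[of "image_mset (\<lambda>x. x - 1) M" n for M] Suc_pred
      by (auto simp: f_def g_def simp del: image_mset_union)
    show "\<forall>N\<in>?P. f (g N) = N"
    proof
      fix N assume "N \<in> ?P"
      then have "\<forall>y\<in>#N. y \<noteq> 0"
        by (metis (no_types, lifting) mem_Collect_eq)
      then have "filter_mset (\<lambda>x. x \<noteq> 0) N = N"
        by (simp only: filter_mset_eq_conv) simp
      then show "f (g N) = N"
        by (simp add: f_def g_def multiset.map_comp comp_def)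
    qed
    show "f ` ?E \<subseteq> ?P"
    proof (intro image_subsetI CollectI conjI)
      fix M assume "M \<in> ?E"
      then have M: "0 \<notin># M" "sum_mset M = x + size M" "n = size M"
        by auto
      show "0 \<notin># f M"
        by (simp add: f_def)
      show "sum_mset (f M) = x"
        using sum_mset_image_Suc[of "image_mset (\<lambda>x. x - 1) M"] Suc_pred[OF M(1)] M(2)
        unfolding f_def sum_mset_filter_nonzero by simp
      show "size (f M) \<le> n"
        using M(3) size_filter_mset_lesseq[of "\<lambda>x. x \<noteq> 0" "image_mset (\<lambda>x. x - 1) M"] by (simp add: f_def)
    qed
    show "g ` ?P \<subseteq> ?E"
      by (auto simp: g_def sum_mset_image_Suc simp del: image_mset_union)
  qed
  then show ?thesis
    unfolding p_le_def by (rule bij_betw_same_card)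
qed

text \<open>
  The first summand counts the partitions with at most \<open>n\<close> parts, the second those with
  exactly \<open>n + 1\<close>. There are none of the latter if \<open>x < n + 1\<close>, a case that has to be kept
  apart because the subtraction would truncate to \<open>p_le (Suc n) 0 = 1\<close>.
\<close>

lemma p_le_Suc:
  "p_le (Suc n) x = p_le n x + (if Suc n \<le> x then p_le (Suc n) (x - Suc n) else 0)"
proof -
  let ?S = "\<lambda>Q. {M :: nat multiset. 0 \<notin># M \<and> sum_mset M = x \<and> Q (size M)}"
  have split: "?S (\<lambda>s. s \<le> Suc n) = ?S (\<lambda>s. s \<le> n) \<union> ?S (\<lambda>s. s = Suc n)"
    by auto
  have fin: "finite (?S (\<lambda>s. s = Suc n))"
    by (rule finite_subset[OF _ finite_p_le[of x "Suc n"]]) auto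
  have "p_le (Suc n) x = p_le n x + card (?S (\<lambda>s. s = Suc n))"
    unfolding p_le_def split by (rule card_Un_disjoint[OF finite_p_le fin]) auto
  also have "card (?S (\<lambda>s. s = Suc n)) = (if Suc n \<le> x then p_le (Suc n) (x - Suc n) else 0)"
  proof (cases "Suc n \<le> x")
    case True
    then show ?thesis
      using card_partitions_exact[of "x - Suc n" "Suc n"] by simp
  next
    case False
    have "size M \<le> sum_mset M" if "0 \<notin># M" for M :: "nat multiset"
      using that by (induction M) auto
    then have "?S (\<lambda>s. s = Suc n) = {}"
      using False by force
    then have "card (?S (\<lambda>s. s = Suc n)) = 0"
      by (simp only: card.empty)
    then show ?thesis
      using False by simp
  qed
  finally show ?thesis .
qed

section \<open>The product formula\<close>

lemma fps2_nth: "fps2 a $ x $ n = a n x"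
  by (simp add: fps2_def)

lemma var_z_var_w_power_mult_nth:
  "(var_z * var_w ^ m * f) $ x $ n
    = (if x < m \<or> n = 0 then 0 else f $ (x - m) $ (n - 1))"
proof -
  have "var_z * var_w ^ m * f = fps_X ^ m * (fps_const fps_X * f)"
    by (simp add: var_z_def var_w_def mult_ac)
  then show ?thesis
    by (simp add: fps_X_power_mult_nth)
qed

text \<open>The series \<open>F(z w^m, w)\<close>, where \<open>F\<close> is the double series of \<^const>\<open>p_le\<close>.\<close>

definition partition_series :: "nat \<Rightarrow> 'a::comm_ring_1 fps fps" where
  "partition_series m = fps2 (\<lambda>n x. if n * m \<le> x then of_nat (p_le n (x - n * m)) else 0)"

text \<open>
  At \<open>z^n w^x\<close>, with \<open>n > 0\<close> and \<open>y = x - n m\<close>, the left side is \<open>p_le n y - p_le (n - 1) y\<close>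
  and the right side is \<open>p_le n (y - n)\<close>, so the equation is \<open>p_le_Suc\<close>.
\<close>

lemma partition_series_step:
  "(1 - var_z * var_w ^ m) * partition_series m = (partition_series (Suc m) :: 'a::comm_ring_1 fps fps)"
proof (intro fps_ext)
  fix x n
  let ?F = "partition_series :: nat \<Rightarrow> 'a fps fps"
  have "((1 - var_z * var_w ^ m) * ?F m) $ x $ n
      = ?F m $ x $ n - (if x < m \<or> n = 0 then 0 else ?F m $ (x - m) $ (n - 1))"
    by (simp add: left_diff_distrib var_z_var_w_power_mult_nth)
  also have "\<dots> = ?F (Suc m) $ x $ n"
  proof (cases n)
    case 0
    then show ?thesis
      by (simp add: partition_series_def fps2_nth)
  next
    case (Suc k)
    show ?thesis
    proof (cases "Suc k * m \<le> x")
      case True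
      define y where "y = x - Suc k * m"
      have "?F m $ x $ n = of_nat (p_le (Suc k) y)"
        using True by (simp only: partition_series_def fps2_nth Suc if_True y_def)
      moreover have "?F m $ (x - m) $ (n - 1) = of_nat (p_le k y)" "\<not> x < m"
        using True by (auto simp: partition_series_def fps2_nth Suc y_def)
      moreover have "?F (Suc m) $ x $ n = of_nat (if Suc k \<le> y then p_le (Suc k) (y - Suc k) else 0)"
      proof -
        have "Suc k * Suc m \<le> x \<longleftrightarrow> Suc k \<le> y" "x - Suc k * Suc m = y - Suc k"
          using True by (auto simp: algebra_simps y_def)
        then show ?thesis
          by (simp only: partition_series_def fps2_nth Suc) simp
      qed
      ultimately show ?thesis
        using Suc by (simp add: p_le_Suc[of k y])
    next
      case False
      then show ?thesis
        by (auto simp: partition_series_def fps2_nth Suc)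
    qed
  qed
  finally show "((1 - var_z * var_w ^ m) * ?F m) $ x $ n = ?F (Suc m) $ x $ n" .
qed

lemma prod_mult_partition_series:
  "(\<Prod>i<m. 1 - var_z * var_w ^ i) * partition_series 0
    = (partition_series m :: 'a::comm_ring_1 fps fps)"
proof (induction m)
  case (Suc m)
  have "(\<Prod>i<Suc m. 1 - var_z * var_w ^ i) * partition_series 0
      = (1 - var_z * var_w ^ m) * ((\<Prod>i<m. 1 - var_z * var_w ^ i) * (partition_series 0 :: 'a fps fps))"
    by (simp add: mult_ac)
  then show ?case
    by (simp only: Suc.IH partition_series_step)
qed simp

text \<open>
  In \<open>F(z w^m, w)\<close> every term with a positive power of \<open>z\<close> carries at least \<open>w^m\<close>, and the
  terms free of \<open>z\<close> add up to \<open>F(0, w) = 1\<close>.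
\<close>

lemma partition_series_nth_low:
  assumes "x < m"
  shows "partition_series m $ x = (1 :: 'a::comm_ring_1 fps fps) $ x"
proof (rule fps_ext)
  fix n
  show "partition_series m $ x $ n = (1 :: 'a fps fps) $ x $ n"
  proof (cases n)
    case (Suc k)
    with assms show ?thesis
      by (simp add: partition_series_def fps2_nth)
  qed (simp add: partition_series_def fps2_nth p_le_0)
qed

lemma fps_mult_nth_cong:
  assumes "\<And>i. i \<le> n \<Longrightarrow> f $ i = g $ i"
  shows "(h * f) $ n = (h * g) $ n"
  using assms by (simp add: fps_mult_nth)

text \<open>
  A series in \<open>w\<close> is invertible as soon as its constant coefficient is a unit. That coefficient
  is itself a series in \<open>z\<close>, namely \<open>1 - z\<close> or 1, and a unit since its own constant term is 1.
\<close>

lemma inverse_one_minus_var_z_var_w_power: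
  "inverse (1 - var_z * var_w ^ i) * (1 - var_z * var_w ^ i) = (1 :: 'a::field fps fps)"
proof -
  let ?f = "1 - var_z * var_w ^ i :: 'a fps fps"
  have "?f $ 0 $ 0 = 1"
    by (simp add: var_z_def)
  then have "?f $ 0 * inverse (?f $ 0) = 1"
    by (metis inverse_mult_eq_1' zero_neq_one)
  then have "?f * inverse ?f = 1"
    unfolding fps_inverse_def by (rule fps_right_inverse)
  then show ?thesis
    by (simp add: mult.commute)
qed

text \<open>
  Multiplying \<open>prod_mult_partition_series\<close> by the inverse factors gives
  \<open>F(z, w) = P * F(z w^m, w)\<close> with \<open>P\<close> the partial product, and the second factor
  is 1 up to terms that cannot reach the coefficients of \<open>w^x\<close> with \<open>x < m\<close>.
\<close>

lemma partition_series_has_prod: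
  "(\<lambda>i. inverse (1 - var_z * var_w ^ i)) has_prod
    (fps2 (\<lambda>n x. of_nat (p_le n x)) :: 'a::field fps fps)"
proof -
  let ?F = "partition_series :: nat \<Rightarrow> 'a fps fps"
  define P :: "nat \<Rightarrow> 'a fps fps" where "P m = (\<Prod>i<m. inverse (1 - var_z * var_w ^ i))" for m
  have F0: "?F 0 = fps2 (\<lambda>n x. of_nat (p_le n x))"
    by (simp add: partition_series_def)
  have F_eq: "?F 0 = P m * ?F m" for m
  proof -
    have "P m * (\<Prod>i<m. 1 - var_z * var_w ^ i) = 1"
      unfolding P_def prod.distrib[symmetric] by (simp add: inverse_one_minus_var_z_var_w_power)
    then have "?F 0 = P m * (\<Prod>i<m. 1 - var_z * var_w ^ i) * ?F 0"
      by simp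
    also have "\<dots> = P m * ?F m"
      by (simp only: mult.assoc prod_mult_partition_series)
    finally show ?thesis .
  qed
  have agree: "P m $ x = ?F 0 $ x" if "x < m" for m x
  proof -
    have "(P m * ?F m) $ x = (P m * 1) $ x"
      using that by (intro fps_mult_nth_cong partition_series_nth_low) simp
    then show ?thesis
      by (simp flip: F_eq)
  qed
  have "(\<lambda>m. P (Suc m)) \<longlonglongrightarrow> ?F 0"
  proof (rule tendsto_fpsI)
    show "eventually (\<lambda>m. P (Suc m) $ x = ?F 0 $ x) sequentially" for x
      using eventually_ge_at_top[of x] by eventually_elim (simp add: agree)
  qed
  moreover have "?F 0 \<noteq> 0"
  proof
    assume "?F 0 = 0"
    then have "?F 0 $ 0 $ 0 = 0"
      by simp
    then show False
      by (simp add: partition_series_def fps2_nth p_le_0)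
  qed
  ultimately show ?thesis
    by (simp add: has_prod_def raw_has_prod_def P_def F0 lessThan_Suc_atMost)
qed

section \<open>Generating functions of the orbit counts\<close>

theorem theorem15p1:
  shows
    "(\<forall>n::nat.
        Abs_fps (\<lambda>x. of_nat (n ^ x) / fact x) = (fps_exp (of_nat n) :: 'a::field_char_0 fps)
      \<and> Abs_fps (\<lambda>x. of_nat ((1 + n) ^ x) / fact x) = (fps_exp (of_nat (1 + n)) :: 'a fps))
   \<and> (\<forall>n::nat.
        Abs_fps (\<lambda>x. of_nat (\<Sum>k=0..n. Stirling x k) / fact x)
          = (\<Sum>k=0..n. (fps_exp 1 - 1) ^ k / fact k :: 'a fps)
      \<and> Abs_fps (\<lambda>x. of_nat (\<Sum>k=0..x. \<Sum>l=0..n. (x choose k) * Stirling k l) / fact x)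
          = (fps_exp 1 * (\<Sum>l=0..n. (fps_exp 1 - 1) ^ l / fact l) :: 'a fps))
   \<and> (\<forall>n::nat.
        Abs_fps (\<lambda>x. (of_nat n + of_nat x - 1) gchoose x) = ((1 - fps_X) powi (- int n) :: 'a fps)
      \<and> Abs_fps (\<lambda>x. of_nat ((n + x) choose x)) = ((1 - fps_X) powi (- (int n + 1)) :: 'a fps))
   \<and> (\<lambda>i. inverse (1 - var_z * var_w ^ i)) has_prod
        (fps2 (\<lambda>n x. of_nat (p_le n x)) :: 'a fps fps)"
proof (intro conjI allI)
  fix n :: nat
  show "Abs_fps (\<lambda>x. of_nat (n ^ x) / fact x) = (fps_exp (of_nat n) :: 'a fps)"
    "Abs_fps (\<lambda>x. of_nat ((1 + n) ^ x) / fact x) = (fps_exp (of_nat (1 + n)) :: 'a fps)"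
    by (rule fps_ext, simp)+
  show "Abs_fps (\<lambda>x. of_nat (\<Sum>k=0..n. Stirling x k) / fact x)
      = (\<Sum>k=0..n. (fps_exp 1 - 1) ^ k / fact k :: 'a fps)"
    by (rule Stirling_sum_egf)
  show "Abs_fps (\<lambda>x. of_nat (\<Sum>k=0..x. \<Sum>l=0..n. (x choose k) * Stirling k l) / fact x)
      = (fps_exp 1 * (\<Sum>l=0..n. (fps_exp 1 - 1) ^ l / fact l) :: 'a fps)"
    unfolding Stirling_sum_egf[symmetric] sum_distrib_left[symmetric]
    by (rule binomial_convolution_egf)
  show "Abs_fps (\<lambda>x. (of_nat n + of_nat x - 1) gchoose x) = ((1 - fps_X) powi (- int n) :: 'a fps)"
    by (rule fps_ext) (simp add: one_minus_fps_X_powi_minus_nth)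
  show "Abs_fps (\<lambda>x. of_nat ((n + x) choose x)) = ((1 - fps_X) powi (- (int n + 1)) :: 'a fps)"
  proof (rule fps_ext)
    fix x
    show "Abs_fps (\<lambda>x. of_nat ((n + x) choose x)) $ x = ((1 - fps_X) powi (- (int n + 1)) :: 'a fps) $ x"
      using one_minus_fps_X_powi_minus_nth[of "Suc n" x, where 'a = 'a]
      by (simp add: binomial_gbinomial add.commute)
  qed
next
  show "(\<lambda>i. inverse (1 - var_z * var_w ^ i)) has_prod
      (fps2 (\<lambda>n x. of_nat (p_le n x)) :: 'a fps fps)"
    by (rule partition_series_has_prod)
qed

end
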